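(* Let $X$ be a nonempty set, and let $T\colon X\times X\to\mathbb{C}$ and $F\colon X\times X\to(0,+\infty)$ satisfy $$|T(f,h)-T(f,g)T(g,h)|\leq F(f,g)F(g,h)-F(f,h)\quad\text{for all } f,g,h\in X.$$ If there exist $f,g\in X$ such that the map $$X\ni k\mapsto \frac{T(g,k)}{F(f,k)}$$ is unbounded, then $T$ solves the Sincov equation, i.e. $$T(f,h)=T(f,g)T(g,h)\quad\text{for all } f,g,h\in X.$$
   Context: A map $u\colon X\to\mathbb{C}$ is unbounded if $\sup_{k\in X}|u(k)|=+\infty$. No structure on the set $X$ is assumed. *)

theory Defs
  imports Complex_Main "HOL-Library.Extended_Real"
begin

text \<open>The supremum is taken in the extended reals, since \<^term>\<open>Sup\<close> on \<^typ>\<open>real\<close>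
  is unspecified for sets that are not bounded above.\<close>

definition unbounded_on :: "'a set \<Rightarrow> ('a \<Rightarrow> complex) \<Rightarrow> bool" where
  "unbounded_on X u \<longleftrightarrow> (SUP k\<in>X. ereal (cmod (u k))) = \<infinity>"

end

theory Submission imports Defs begin

text \<open>The hypothesis makes \<^term>\<open>F\<close> submultiplicative, so replacing the base point of \<^term>\<open>F\<close>
  changes growth in the last variable only by a constant factor. The defect
  \<open>D = T(f,h) - T(f,g) T(g,h)\<close>, multiplied by \<open>T(h,k)\<close>, telescopes into three terms, each bounded by
  a constant times \<open>F(h,k)\<close>. If \<open>D \<noteq> 0\<close>, this bounds \<open>T(h,k) / F(h,k)\<close> in \<open>k\<close>, and by the hypothesis
  once more also \<open>T(g0,k) / F(f0,k)\<close> for all \<open>f0\<close> and \<open>g0\<close>.\<close>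

lemma unbounded_on_exceeds:
  assumes "unbounded_on X u"
  shows "\<exists>k\<in>X. cmod (u k) > C"
proof (rule ccontr)
  assume "\<not> (\<exists>k\<in>X. cmod (u k) > C)"
  then have "(SUP k\<in>X. ereal (cmod (u k))) \<le> ereal C"
    by (intro SUP_least) (auto simp: not_less)
  with assms show False
    by (simp add: unbounded_on_def)
qed

theorem theorem1:
  fixes X :: "'a set"
    and T :: "'a \<times> 'a \<Rightarrow> complex"
    and F :: "'a \<times> 'a \<Rightarrow> real"
  assumes "X \<noteq> {}"
    and "\<And>f g. f \<in> X \<Longrightarrow> g \<in> X \<Longrightarrow> F (f, g) > 0"
    and "\<And>f g h. f \<in> X \<Longrightarrow> g \<in> X \<Longrightarrow> h \<in> X \<Longrightarrow>
           cmod (T (f, h) - T (f, g) * T (g, h)) \<le> F (f, g) * F (g, h) - F (f, h)"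
    and "\<exists>f\<in>X. \<exists>g\<in>X. unbounded_on X (\<lambda>k. T (g, k) / complex_of_real (F (f, k)))"
  shows "\<forall>f\<in>X. \<forall>g\<in>X. \<forall>h\<in>X. T (f, h) = T (f, g) * T (g, h)"
proof (intro ballI, rule ccontr)
  fix f g h
  assume X: "f \<in> X" "g \<in> X" "h \<in> X" and ne: "T (f, h) \<noteq> T (f, g) * T (g, h)"
  note pos = assms(2)
  have submult: "F (a, c) \<le> F (a, b) * F (b, c)" if "a \<in> X" "b \<in> X" "c \<in> X" for a b c
    using assms(3)[OF that] norm_ge_zero[of "T (a, c) - T (a, b) * T (b, c)"] by linarith
  have defect: "cmod (T (a, c) - T (a, b) * T (b, c)) \<le> F (a, b) * F (b, c)"
    if "a \<in> X" "b \<in> X" "c \<in> X" for a b c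
    using assms(3)[OF that] pos[OF that(1,3)] by linarith
  obtain f0 g0 where X0: "f0 \<in> X" "g0 \<in> X"
    and unb: "unbounded_on X (\<lambda>k. T (g0, k) / complex_of_real (F (f0, k)))"
    using assms(4) by blast
  define D where "D = T (f, h) - T (f, g) * T (g, h)"
  \<comment> \<open>\<open>B\<close> adds up the coefficients of \<open>F (h, k)\<close> in the
    bounds of the three telescoping terms. \<open>C\<close> is what remains when
    \<open>T (g0, k)\<close> is compared with \<open>T (g0, h) * T (h, k)\<close>.\<close>
  define B where "B = F (f, h) + F (f, g) * F (g, h) + cmod (T (f, g)) * F (g, h)"
  define C where "C = cmod (T (g0, h)) * (B / cmod D) + F (g0, h)"
  have D: "cmod D > 0"
    using ne by (simp add: D_def)
  have "B \<ge> 0"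
    unfolding B_def using X pos by (intro add_nonneg_nonneg mult_nonneg_nonneg) (auto intro: less_imp_le)
  then have C: "C \<ge> 0"
    unfolding C_def using X X0 pos
    by (intro add_nonneg_nonneg mult_nonneg_nonneg divide_nonneg_nonneg) (auto intro: less_imp_le)
  have T_h: "cmod (T (h, k)) \<le> B / cmod D * F (h, k)" if k: "k \<in> X" for k
  proof -
    \<comment> \<open>Adding and subtracting \<open>T (f, k)\<close> and
      \<open>T (f, g) * T (g, k)\<close> turns each bracket into a defect with last argument
      \<open>k\<close>.\<close>
    have eq: "D * T (h, k) = - (T (f, k) - T (f, h) * T (h, k)) + (T (f, k) - T (f, g) * T (g, k))
        + T (f, g) * (T (g, k) - T (g, h) * T (h, k))"
      by (simp add: D_def algebra_simps)
    have "cmod D * cmod (T (h, k)) \<le> cmod (T (f, k) - T (f, h) * T (h, k))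
        + cmod (T (f, k) - T (f, g) * T (g, k))
        + cmod (T (f, g)) * cmod (T (g, k) - T (g, h) * T (h, k))"
      unfolding norm_mult[symmetric] eq
      by (intro norm_triangle_mono) (simp_all only: norm_minus_cancel order_refl)
    also have "\<dots> \<le> F (f, h) * F (h, k) + F (f, g) * (F (g, h) * F (h, k))
        + cmod (T (f, g)) * (F (g, h) * F (h, k))"
    proof (intro add_mono mult_left_mono)
      \<comment> \<open>Only this defect is bounded through \<open>F (g, k)\<close>; a detour via
        \<open>h\<close> gives it the common factor \<open>F (h, k)\<close>.\<close>
      have "F (f, g) * F (g, k) \<le> F (f, g) * (F (g, h) * F (h, k))"
        using X k pos by (intro mult_left_mono submult) (auto intro: less_imp_le)
      then show "cmod (T (f, k) - T (f, g) * T (g, k)) \<le> F (f, g) * (F (g, h) * F (h, k))"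
        using defect[OF X(1,2) k] by linarith
    qed (use X k defect in auto)
    also have "\<dots> = B * F (h, k)"
      by (simp add: B_def algebra_simps)
    finally show ?thesis
      using D by (simp add: field_simps)
  qed
  have "cmod (T (g0, k)) \<le> C * F (h, f0) * F (f0, k)" if k: "k \<in> X" for k
  proof -
    have "cmod (T (g0, k)) \<le> cmod (T (g0, h)) * cmod (T (h, k)) + F (g0, h) * F (h, k)"
      using defect[OF X0(2) X(3) k] norm_triangle_sub[of "T (g0, k)" "T (g0, h) * T (h, k)"]
      by (simp add: norm_mult)
    also have "\<dots> \<le> cmod (T (g0, h)) * (B / cmod D * F (h, k)) + F (g0, h) * F (h, k)"
      using T_h[OF k] by (intro add_right_mono mult_left_mono norm_ge_zero)
    also have "\<dots> = C * F (h, k)"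
      by (simp add: C_def algebra_simps)
    \<comment> \<open>The base point moves from \<open>h\<close> to \<open>f0\<close>, at the cost
      of a factor independent of \<open>k\<close>; it then enters the threshold that the unbounded
      quotient must exceed.\<close>
    also have "\<dots> \<le> C * (F (h, f0) * F (f0, k))"
      using X X0 k C by (intro mult_left_mono submult)
    finally show ?thesis
      by (simp add: mult.assoc)
  qed
  moreover obtain k where k: "k \<in> X"
    and "C * F (h, f0) < cmod (T (g0, k) / complex_of_real (F (f0, k)))"
    using unbounded_on_exceeds[OF unb] by blast
  then have "C * F (h, f0) * F (f0, k) < cmod (T (g0, k))"
    using pos[OF X0(1) k] by (simp add: norm_divide field_simps)
  ultimately show False
    using k by fastforce
qed

end
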